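(* On $\mathbb{R}^{2n}$ with coordinates $z^i=(q^a,p_b)$ and canonical Poisson bracket $\{\cdot,\cdot\}_P$, consider the system $$\dot z^i=\{z^i,H\}_P,\qquad \Phi^\alpha(z)=0,\quad \alpha=1,\dots,2p<2n,$$ where $H$ is a given function and $\Phi^\alpha$ are functionally independent functions. If the system is self-consistent, then $$\{\Phi^\alpha,H\}_P\big|_{\Phi^\alpha=0}=0,$$ i.e. the functions $\{\Phi^\alpha,H\}_P$ vanish at all points of the surface $\{z:\Phi^\alpha(z)=0 \text{ for all }\alpha\}$.
   Context: All objects are smooth. Repeated indices are summed and $\dot z^i=dz^i/d\tau$. The canonical Poisson bracket is $\{A,B\}_P=\frac{\partial A}{\partial q^a}\frac{\partial B}{\partial p_a}-\frac{\partial B}{\partial q^a}\frac{\partial A}{\partial p_a}$. Functions $\Phi^\alpha$, $\alpha=1,\dots,2p$, are functionally independent if $\operatorname{rank}(\partial_i\Phi^\alpha)=2p$. The system is called self-consistent if through any point of the surface $\{\Phi^\alpha=0\}$ passes a solution of the system, i.e. a curve $z^i(\tau)$ satisfying the differential equations and $\Phi^\alpha(z(\tau))=0$ for all $\tau$. *)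

theory Defs
  imports "HOL-Analysis.Analysis"
begin

text \<open>
  Phase space \<open>\<real>\<^sup>2\<^sup>n\<close> with \<open>n = CARD('n)\<close> is \<open>real ^ ('n + 'n)\<close>: the position \<open>q\<^sup>a\<close> is the
  coordinate \<open>Inl a\<close> and the momentum \<open>p\<^sub>a\<close> is the coordinate \<open>Inr a\<close>.
\<close>

text \<open>
  \<open>C\<^sup>k\<close> regularity through iterated directional derivatives; meant for open \<open>S\<close> in a
  finite-dimensional space.
\<close>

primrec Ck_on :: "nat \<Rightarrow> 'a::euclidean_space set \<Rightarrow> ('a \<Rightarrow> 'b::real_normed_vector) \<Rightarrow> bool" where
  "Ck_on 0 S f \<longleftrightarrow> continuous_on S f"
| "Ck_on (Suc k) S f \<longleftrightarrow>
     (\<forall>x\<in>S. f differentiable at x) \<and>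
     (\<forall>v. Ck_on k S (\<lambda>x. frechet_derivative f (at x) v))"

definition smooth_on :: "'a::euclidean_space set \<Rightarrow> ('a \<Rightarrow> 'b::real_normed_vector) \<Rightarrow> bool" where
  "smooth_on S f \<longleftrightarrow> (\<forall>k. Ck_on k S f)"

definition partial_deriv :: "'i::finite \<Rightarrow> (real ^ 'i \<Rightarrow> real) \<Rightarrow> real ^ 'i \<Rightarrow> real" where
  "partial_deriv i A z = deriv (\<lambda>t. A (z + t *\<^sub>R axis i 1)) 0"

definition poisson ::
  "(real ^ ('n::finite + 'n) \<Rightarrow> real) \<Rightarrow> (real ^ ('n + 'n) \<Rightarrow> real) \<Rightarrow> real ^ ('n + 'n) \<Rightarrow> real" where
  "poisson A B z =
     (\<Sum>a\<in>UNIV. partial_deriv (Inl a) A z * partial_deriv (Inr a) B z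
              - partial_deriv (Inl a) B z * partial_deriv (Inr a) A z)"

definition functionally_independent :: "('m::finite \<Rightarrow> real ^ 'i::finite \<Rightarrow> real) \<Rightarrow> bool" where
  "functionally_independent \<Phi> \<longleftrightarrow>
     (\<forall>z. rank (\<chi> \<alpha> i. partial_deriv i (\<Phi> \<alpha>) z) = CARD('m))"

definition constraint_surface :: "('m \<Rightarrow> 'a \<Rightarrow> real) \<Rightarrow> 'a set" where
  "constraint_surface \<Phi> = {z. \<forall>\<alpha>. \<Phi> \<alpha> z = 0}"

text \<open>
  Solutions are local: the parameter \<open>\<tau>\<close> runs over an open interval \<open>I\<close>, since the flow of
  \<open>H\<close> need not be complete.
\<close>

definition is_solution ::
  "(real ^ ('n::finite + 'n) \<Rightarrow> real) \<Rightarrow> ('m \<Rightarrow> real ^ ('n + 'n) \<Rightarrow> real) \<Rightarrow>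
   real set \<Rightarrow> (real \<Rightarrow> real ^ ('n + 'n)) \<Rightarrow> bool" where
  "is_solution H \<Phi> I z \<longleftrightarrow>
     open I \<and> is_interval I \<and> smooth_on I z \<and>
     (\<forall>\<tau>\<in>I. \<forall>i. ((\<lambda>t. z t $ i) has_real_derivative poisson (\<lambda>w. w $ i) H (z \<tau>)) (at \<tau>)) \<and>
     (\<forall>\<tau>\<in>I. \<forall>\<alpha>. \<Phi> \<alpha> (z \<tau>) = 0)"

definition self_consistent ::
  "(real ^ ('n::finite + 'n) \<Rightarrow> real) \<Rightarrow> ('m \<Rightarrow> real ^ ('n + 'n) \<Rightarrow> real) \<Rightarrow> bool" where
  "self_consistent H \<Phi> \<longleftrightarrow>
     (\<forall>z0\<in>constraint_surface \<Phi>. \<exists>I z. is_solution H \<Phi> I z \<and> (\<exists>\<tau>\<in>I. z \<tau> = z0))"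

end

theory Submission
  imports Defs
begin

text \<open>Self-consistency puts a solution curve, lying in the surface, through each point of the
  surface. Along it every constraint is identically zero, so its time derivative is zero; by the
  chain rule and the equations of motion that derivative is also the bracket with \<open>H\<close>.
  The second half is \<open>has_derivative_along_hamiltonian_curve\<close>, which rests on
  \<open>poisson_eq_sum_poisson_nth\<close>.\<close>

text \<open>Links the one-variable derivatives inside \<open>poisson\<close> to the Frechet
  derivative, for which the chain rule is available.\<close>

lemma partial_deriv_eq_has_derivative:
  assumes "(A has_derivative D) (at z)"
  shows "partial_deriv i A z = D (axis i 1)"
proof -
  have line: "((\<lambda>t. z + t *\<^sub>R axis i 1) has_derivative (\<lambda>t. t *\<^sub>R axis i 1)) (at (0::real))"
    by (auto intro!: derivative_eq_intros)
  have "((\<lambda>t. A (z + t *\<^sub>R axis i 1)) has_derivative (\<lambda>t. D (t *\<^sub>R axis i 1))) (at 0)"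
    using has_derivative_compose[OF line, of A D] assms by simp
  moreover have "D (t *\<^sub>R axis i 1) = D (axis i 1) * t" for t
    using linear_cmul[OF has_derivative_linear[OF assms]] by simp
  ultimately have "((\<lambda>t. A (z + t *\<^sub>R axis i 1)) has_field_derivative D (axis i 1)) (at 0)"
    by (simp add: has_field_derivative_def)
  then show ?thesis
    unfolding partial_deriv_def by (rule DERIV_imp_deriv)
qed

lemma partial_deriv_nth:
  "partial_deriv j (\<lambda>w. w $ i) z = (if i = j then 1 else 0)"
proof -
  have "((\<lambda>w. w $ i) has_derivative (\<lambda>w. w $ i)) (at z)"
    by (rule bounded_linear_imp_has_derivative[OF bounded_linear_vec_nth])
  from partial_deriv_eq_has_derivative[OF this] show ?thesis
    by (simp add: axis_def)
qed

lemma poisson_nth_Inl: "poisson (\<lambda>w. w $ Inl a) H z = partial_deriv (Inr a) H z"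
proof -
  have "poisson (\<lambda>w. w $ Inl a) H z = (\<Sum>b\<in>UNIV. if a = b then partial_deriv (Inr b) H z else 0)"
    unfolding poisson_def partial_deriv_nth by (intro sum.cong) auto
  then show ?thesis by simp
qed

lemma poisson_nth_Inr: "poisson (\<lambda>w. w $ Inr a) H z = - partial_deriv (Inl a) H z"
proof -
  have "poisson (\<lambda>w. w $ Inr a) H z = (\<Sum>b\<in>UNIV. if a = b then - partial_deriv (Inl b) H z else 0)"
    unfolding poisson_def partial_deriv_nth by (intro sum.cong) auto
  then show ?thesis by simp
qed

text \<open>Bracketing with \<open>H\<close> is a first-order differential operator, so its values
  on the coordinate functions, the components of the Hamiltonian vector field, determine it.
  Splitting the index type into positions and momenta recovers the two terms of the bracket.\<close>

lemma poisson_eq_sum_poisson_nth: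
  "poisson A H z = (\<Sum>i\<in>UNIV. partial_deriv i A z * poisson (\<lambda>w. w $ i) H z)"
  unfolding UNIV_Plus_UNIV[symmetric]
  by (subst sum.Plus)
     (simp_all add: poisson_nth_Inl poisson_nth_Inr poisson_def[of A] sum_subtractf sum_negf mult.commute)

text \<open>The chain rule, with the Hamiltonian vector field as velocity.\<close>

lemma has_derivative_along_hamiltonian_curve:
  fixes A H :: "real ^ ('n::finite + 'n) \<Rightarrow> real"
  assumes "A differentiable at (z \<tau>)"
    and "\<And>i. ((\<lambda>t. z t $ i) has_real_derivative poisson (\<lambda>w. w $ i) H (z \<tau>)) (at \<tau>)"
  shows "((\<lambda>t. A (z t)) has_real_derivative poisson A H (z \<tau>)) (at \<tau>)"
proof -
  define v where "v = (\<chi> i. poisson (\<lambda>w. w $ i) H (z \<tau>))"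
  obtain D where D: "(A has_derivative D) (at (z \<tau>))"
    using assms(1) by (auto simp: differentiable_def)
  have lin: "linear D"
    using D by (rule has_derivative_linear)
  \<comment> \<open>The equations of motion are given coordinatewise; testing against the standard
    basis assembles them into one vector derivative.\<close>
  have "((\<lambda>t. z t) has_derivative (\<lambda>h. h *\<^sub>R v)) (at \<tau>)"
    unfolding has_derivative_componentwise_within[of z]
  proof
    fix b :: "real ^ ('n + 'n)" assume "b \<in> Basis"
    then obtain i where b: "b = axis i 1"
      by (auto simp: Basis_vec_def)
    show "((\<lambda>t. z t \<bullet> b) has_derivative (\<lambda>h. h *\<^sub>R v \<bullet> b)) (at \<tau>)"
      using assms(2)[of i]
      by (simp add: b inner_axis v_def has_field_derivative_def mult_commute_abs)
  qed
  from has_derivative_compose[OF this D]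
  have "((\<lambda>t. A (z t)) has_real_derivative D v) (at \<tau>)"
    by (simp add: has_field_derivative_def linear_cmul[OF lin] mult_commute_abs)
  \<comment> \<open>Linearity of \<open>D\<close> on the basis expansion of \<open>v\<close> brings
    out the partial derivatives of \<open>A\<close>.\<close>
  moreover have "D v = (\<Sum>i\<in>UNIV. v $ i * D (axis i 1))"
    using arg_cong[OF basis_expansion[of v], of D]
    by (simp add: linear_sum[OF lin] linear_cmul[OF lin] scalar_mult_eq_scaleR)
  then have "D v = poisson A H (z \<tau>)"
    by (simp add: poisson_eq_sum_poisson_nth[of A] partial_deriv_eq_has_derivative[OF D] v_def mult.commute)
  ultimately show ?thesis by simp
qed

theorem mainTheorem12:
  fixes H :: "real ^ ('n::finite + 'n) \<Rightarrow> real"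
    and \<Phi> :: "'m::finite \<Rightarrow> real ^ ('n + 'n) \<Rightarrow> real"
    and p :: nat
  assumes "CARD('m) = 2 * p"
    and "2 * p < 2 * CARD('n)"
    and "smooth_on UNIV H"
    and "\<And>\<alpha>. smooth_on UNIV (\<Phi> \<alpha>)"
    and "functionally_independent \<Phi>"
    and "self_consistent H \<Phi>"
  shows "\<forall>z\<in>constraint_surface \<Phi>. \<forall>\<alpha>. poisson (\<Phi> \<alpha>) H z = 0"
proof (intro ballI allI)
  fix z0 \<alpha> assume "z0 \<in> constraint_surface \<Phi>"
  then obtain I z \<tau> where sol: "is_solution H \<Phi> I z" and \<tau>: "\<tau> \<in> I" "z \<tau> = z0"
    using assms(6) unfolding self_consistent_def by blast
  \<comment> \<open>Order one is taken because \<open>Ck_on 0\<close> gives only continuity.\<close>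
  have "Ck_on (Suc 0) UNIV (\<Phi> \<alpha>)"
    using assms(4)[of \<alpha>] unfolding smooth_on_def by blast
  then have "\<Phi> \<alpha> differentiable at (z \<tau>)"
    by simp
  then have "((\<lambda>t. \<Phi> \<alpha> (z t)) has_real_derivative poisson (\<Phi> \<alpha>) H (z \<tau>)) (at \<tau>)"
    using sol \<tau>(1) unfolding is_solution_def
    by (intro has_derivative_along_hamiltonian_curve[where A = "\<Phi> \<alpha>" and z = z]) blast+
  \<comment> \<open>The constraint vanishes along the curve on all of the open set \<open>I\<close>
    around \<open>\<tau>\<close>, and derivatives are local.\<close>
  moreover have "((\<lambda>t. \<Phi> \<alpha> (z t)) has_real_derivative 0) (at \<tau>)"
    using sol \<tau>(1) unfolding is_solution_def
    by (intro has_field_derivative_transform_within_open[OF DERIV_const[of 0], of I]) auto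
  ultimately show "poisson (\<Phi> \<alpha>) H z0 = 0"
    using \<tau>(2) DERIV_unique by blast
qed

end
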